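(* Let $\{M_i\}_{i\in I}$ be a family of pointed metric spaces, let $Y$ be a Banach space, and let $M=\coprod_{i\in I}M_i$ be the metric sum. Then the following are equivalent: (1) $\mathrm{LipSNA}_K(M_i,Y)$ is dense in $\mathrm{Lip}_{0K}(M_i,Y)$ for every $i\in I$. (2) $\mathrm{LipSNA}_K(M,Y)$ is dense in $\mathrm{Lip}_{0K}(M,Y)$.
   Context: All metric spaces are complete and all Banach spaces are real. A pointed metric space is a metric space $(M,d)$ with a distinguished point $0\in M$; pointed metric spaces are taken to have at least two points, and the index set $I$ is nonempty. For a Banach space $Y$, $\mathrm{Lip}_0(M,Y)$ is the Banach space of Lipschitz maps $F\colon M\to Y$ with $F(0)=0$, with the norm $\|F\|_L=\sup\{\|F(p)-F(q)\|/d(p,q)\colon p,q\in M,\ p\neq q\}$. A map $F\in \mathrm{Lip}_0(M,Y)$ is Lipschitz compact if the set $\{(F(p)-F(q))/d(p,q)\colon p,q\in M,\ p\neq q\}$ is relatively compact in $Y$; $\mathrm{Lip}_{0K}(M,Y)$ denotes the space of such maps. $F$ strongly attains its norm if there are $p\neq q$ in $M$ with $\|F(p)-F(q)\|/d(p,q)=\|F\|_L$; $\mathrm{LipSNA}_K(M,Y)$ is the set of Lipschitz compact maps in $\mathrm{Lip}_0(M,Y)$ which strongly attain their norm. Density is with respect to $\|\cdot\|_L$. The (metric) sum $\coprod_{i\in I}M_i$ of a family of pointed metric spaces $(M_i,d_i)$ is the disjoint union of the $M_i$ with all base points identified to one point $0$ (the base point), with the metric $d(x,y)=d_i(x,y)$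 if $x,y\in M_i$, and $d(x,y)=d_i(x,0)+d_j(0,y)$ if $x\in M_i$, $y\in M_j$, $i\neq j$. *)

theory Defs
  imports "HOL-Analysis.Analysis"
begin

definition pointed_metric_space :: "'a metric \<Rightarrow> 'a \<Rightarrow> bool" where
  "pointed_metric_space m z \<longleftrightarrow> z \<in> mspace m \<and> (\<exists>x\<in>mspace m. x \<noteq> z)"

text \<open>Functions are total, so a map on \<^term>\<open>mspace m\<close> is represented by its extension by zero;
  this makes the set of maps a real vector space under the pointwise operations, on which
  the Lipschitz norm below is a genuine norm.\<close>

definition Lip0 :: "'a metric \<Rightarrow> 'a \<Rightarrow> ('a \<Rightarrow> 'y::real_normed_vector) set" where
  "Lip0 m z = {F. Lipschitz_continuous_map m euclidean_metric F \<and> F z = 0 \<and>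
                  (\<forall>x. x \<notin> mspace m \<longrightarrow> F x = 0)}"

definition lip_norm :: "'a metric \<Rightarrow> ('a \<Rightarrow> 'y::real_normed_vector) \<Rightarrow> real" where
  "lip_norm m F = Sup {norm (F p - F q) / mdist m p q | p q.
                        p \<in> mspace m \<and> q \<in> mspace m \<and> p \<noteq> q}"

definition lip_slopes :: "'a metric \<Rightarrow> ('a \<Rightarrow> 'y::real_normed_vector) \<Rightarrow> 'y set" where
  "lip_slopes m F = {(F p - F q) /\<^sub>R mdist m p q | p q.
                        p \<in> mspace m \<and> q \<in> mspace m \<and> p \<noteq> q}"

definition Lip0K :: "'a metric \<Rightarrow> 'a \<Rightarrow> ('a \<Rightarrow> 'y::real_normed_vector) set" where
  "Lip0K m z = {F \<in> Lip0 m z. compact (closure (lip_slopes m F))}"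

definition strongly_attains_norm :: "'a metric \<Rightarrow> ('a \<Rightarrow> 'y::real_normed_vector) \<Rightarrow> bool" where
  "strongly_attains_norm m F \<longleftrightarrow>
     (\<exists>p\<in>mspace m. \<exists>q\<in>mspace m. p \<noteq> q \<and> norm (F p - F q) / mdist m p q = lip_norm m F)"

definition LipSNAK :: "'a metric \<Rightarrow> 'a \<Rightarrow> ('a \<Rightarrow> 'y::real_normed_vector) set" where
  "LipSNAK m z = {F \<in> Lip0K m z. strongly_attains_norm m F}"

definition lip_dense_in ::
    "'a metric \<Rightarrow> ('a \<Rightarrow> 'y::real_normed_vector) set \<Rightarrow> ('a \<Rightarrow> 'y) set \<Rightarrow> bool" where
  "lip_dense_in m A B \<longleftrightarrow>
     A \<subseteq> B \<and> (\<forall>F\<in>B. \<forall>\<epsilon>>0. \<exists>G\<in>A. lip_norm m (\<lambda>x. F x - G x) < \<epsilon>)"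

text \<open>The point \<^term>\<open>None\<close> is the common base point, and \<^term>\<open>Some (i, x)\<close> is the
  copy of a non-base point \<open>x\<close> of the \<open>i\<close>-th space. The summands are spaces with arbitrary
  carriers inside one type, which covers every family of metric spaces up to isometry.\<close>

definition sum_incl :: "('i \<Rightarrow> 'a) \<Rightarrow> 'i \<Rightarrow> 'a \<Rightarrow> ('i \<times> 'a) option" where
  "sum_incl z i x = (if x = z i then None else Some (i, x))"

fun sum_dist :: "('i \<Rightarrow> 'a metric) \<Rightarrow> ('i \<Rightarrow> 'a) \<Rightarrow>
                 ('i \<times> 'a) option \<Rightarrow> ('i \<times> 'a) option \<Rightarrow> real" where
  "sum_dist M z None None = 0"
| "sum_dist M z None (Some (j, y)) = mdist (M j) (z j) y"
| "sum_dist M z (Some (i, x)) None = mdist (M i) x (z i)"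
| "sum_dist M z (Some (i, x)) (Some (j, y)) =
     (if i = j then mdist (M i) x y else mdist (M i) x (z i) + mdist (M j) (z j) y)"

definition metric_sum :: "'i set \<Rightarrow> ('i \<Rightarrow> 'a metric) \<Rightarrow> ('i \<Rightarrow> 'a) \<Rightarrow> ('i \<times> 'a) option metric" where
  "metric_sum I M z = metric (\<Union>i\<in>I. sum_incl z i ` mspace (M i), sum_dist M z)"

lemma Metric_space_sum:
  assumes "\<And>i. i \<in> I \<Longrightarrow> z i \<in> mspace (M i)"
  shows "Metric_space (\<Union>i\<in>I. sum_incl z i ` mspace (M i)) (sum_dist M z)"
proof
  let ?S = "\<Union>i\<in>I. sum_incl z i ` mspace (M i)"
  have S: "i \<in> I" "x \<in> mspace (M i)" "x \<noteq> z i" if "u \<in> ?S" "u = Some (i, x)" for u i x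
    using that by (auto simp: sum_incl_def split: if_splits)
  fix u v w
  show "0 \<le> sum_dist M z u v"
    by (cases "(M, z, u, v)" rule: sum_dist.cases) auto
  show "sum_dist M z u v = sum_dist M z v u"
    by (cases "(M, z, u, v)" rule: sum_dist.cases) (auto simp: mdist_commute)
  show "sum_dist M z u v = 0 \<longleftrightarrow> u = v" if "u \<in> ?S" "v \<in> ?S"
    using S[OF that(1)] S[OF that(2)] assms
    by (cases u; cases v) (auto simp: add_nonneg_eq_0_iff split: if_splits)
  define r where "r w = sum_dist M z w None" for w
  have r: "r None = 0" "r (Some (i, x)) = mdist (M i) x (z i)" for i x
    by (simp_all add: r_def)
  have r_nonneg: "0 \<le> r w" for w
    by (cases w) (auto simp: r)
  have D: "sum_dist M z (Some (i, x)) w =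
      (case w of None \<Rightarrow> r (Some (i, x)) | Some (j, y) \<Rightarrow>
        if i = j then mdist (M i) x y else r (Some (i, x)) + r w)" for i x w
    by (auto simp: r mdist_commute split: option.split)
  have D0: "sum_dist M z None w = r w" for w
    by (cases w) (auto simp: r mdist_commute)
  have r_le: "r u \<le> sum_dist M z u v + r v"
    if "u \<in> ?S" "v \<in> ?S" for u v
  proof (cases u)
    case None
    then show ?thesis using r_nonneg[of v] by (simp add: D0 r)
  next
    case (Some a)
    obtain i x where u: "u = Some (i, x)" using Some by (cases a) auto
    have x: "i \<in> I" "x \<in> mspace (M i)" using S[OF that(1) u] by blast+
    show ?thesis
    proof (cases "\<exists>y. v = Some (i, y)")
      case True
      then obtain y where v: "v = Some (i, y)" by blast
      have "y \<in> mspace (M i)" using S[OF that(2) v] by blast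
      then show ?thesis
        using mdist_triangle[of x "M i" y "z i"] x assms by (simp add: u v r)
    next
      case False
      then show ?thesis
        using r_nonneg[of v] by (auto simp: u D split: option.split)
    qed
  qed
  have comm: "sum_dist M z u v = sum_dist M z v u" for u v
    by (cases "(M, z, u, v)" rule: sum_dist.cases) (auto simp: mdist_commute)
  have le_r: "sum_dist M z u v \<le> r u + r v" if "u \<in> ?S" "v \<in> ?S" for u v
  proof (cases "u = None \<or> v = None")
    case True
    then show ?thesis using comm[of u v] by (auto simp: D0 r)
  next
    case False
    then obtain i x j y where uv: "u = Some (i, x)" "v = Some (j, y)"
      by (cases u; cases v) auto
    have "i \<in> I" "x \<in> mspace (M i)" "y \<in> mspace (M j)" using S[OF that(1) uv(1)] S[OF that(2) uv(2)] by blast+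
    then show ?thesis
      using mdist_triangle[of x "M i" "z i" y] assms
      by (auto simp: uv r mdist_commute)
  qed
  show "sum_dist M z u w \<le> sum_dist M z u v + sum_dist M z v w"
    if "u \<in> ?S" "v \<in> ?S" "w \<in> ?S"
  proof -
    consider (same) i x y t where "u = Some (i, x)" "v = Some (i, y)" "w = Some (i, t)"
      | (left) "sum_dist M z u v = r u + r v"
      | (right) "sum_dist M z v w = r v + r w"
      | (outer) "v = None"
    proof (cases u; cases v)
      fix a b assume ab: "u = Some a" "v = Some b"
      obtain i x j y where "a = (i, x)" "b = (j, y)" by (cases a; cases b) blast
      with ab have uv: "u = Some (i, x)" "v = Some (j, y)" by auto
      show thesis
      proof (cases w)
        case None
        then have "sum_dist M z v w = r v + r w" by (simp add: r_def)
        then show thesis by (rule right)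
      next
        case (Some c)
        obtain k t where w: "w = Some (k, t)" using Some by (cases c) auto
        show thesis
        proof (cases "i = j")
          case True
          show thesis
          proof (cases "j = k")
            case True
            then show thesis using same[of i x y t] uv w \<open>i = j\<close> by auto
          next
            case False
            then have "sum_dist M z v w = r v + r w" by (simp add: uv w r mdist_commute)
            then show thesis by (rule right)
          qed
        next
          case False
          then have "sum_dist M z u v = r u + r v" by (simp add: uv r mdist_commute)
          then show thesis by (rule left)
        qed
      qed
    next
      fix b assume "u = None" "v = Some b"
      then have "sum_dist M z u v = r u + r v" by (simp add: D0 r)
      then show thesis by (rule left)
    qed (use outer in auto)
    then show ?thesis
    proof cases
      case same
      then have "x \<in> mspace (M i)" "y \<in> mspace (M i)" "t \<in> mspace (M i)"
        using S[OF that(1) same(1)] S[OF that(2) same(2)] S[OF that(3) same(3)] by blast+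
      then show ?thesis using mdist_triangle[of x "M i" y t] by (simp add: same)
    next
      case left
      then show ?thesis
        using le_r[OF that(1,3)] r_le[OF that(3,2)] comm[of v w] by linarith
    next
      case right
      then show ?thesis
        using le_r[OF that(1,3)] r_le[OF that(1,2)] by linarith
    next
      case outer
      then show ?thesis
        using le_r[OF that(1,3)] D0[of w] r_def[of u] by simp
    qed
  qed
qed

lemma
  assumes "\<And>i. i \<in> I \<Longrightarrow> z i \<in> mspace (M i)"
  shows mspace_metric_sum: "mspace (metric_sum I M z) = (\<Union>i\<in>I. sum_incl z i ` mspace (M i))"
    and mdist_metric_sum: "mdist (metric_sum I M z) = sum_dist M z"
  unfolding metric_sum_def
  by (rule Metric_space.mspace_metric Metric_space.mdist_metric, rule Metric_space_sum, erule assms)+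

lemma mdist_metric_sum_incl:
  assumes "\<And>i. i \<in> I \<Longrightarrow> z i \<in> mspace (M i)"
    and "i \<in> I" "j \<in> I" "x \<in> mspace (M i)" "y \<in> mspace (M j)"
  shows "mdist (metric_sum I M z) (sum_incl z i x) (sum_incl z j y) =
    (if i = j then mdist (M i) x y else mdist (M i) x (z i) + mdist (M j) (z j) y)"
proof -
  have "mdist (metric_sum I M z) = sum_dist M z"
    by (rule mdist_metric_sum) (rule assms(1))
  moreover have "mdist (M i) (z i) (z i) = 0" "mdist (M j) (z j) (z j) = 0"
    using assms(1)[OF assms(2)] assms(1)[OF assms(3)] by simp_all
  ultimately show ?thesis
    by (simp add: sum_incl_def)
qed

lemma pointed_metric_space_sum:
  assumes "I \<noteq> {}" "\<And>i. i \<in> I \<Longrightarrow> pointed_metric_space (M i) (z i)"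
  shows "pointed_metric_space (metric_sum I M z) None"
proof -
  obtain i where i: "i \<in> I" using assms(1) by blast
  then obtain x where x: "x \<in> mspace (M i)" "x \<noteq> z i" and z: "z i \<in> mspace (M i)"
    using assms(2) unfolding pointed_metric_space_def by blast
  have "None = sum_incl z i (z i)" "sum_incl z i x \<noteq> None"
    using x by (simp_all add: sum_incl_def)
  moreover have "mspace (metric_sum I M z) = (\<Union>i\<in>I. sum_incl z i ` mspace (M i))"
    by (rule mspace_metric_sum) (use assms(2) in \<open>simp add: pointed_metric_space_def\<close>)
  ultimately show ?thesis
    using i x z unfolding pointed_metric_space_def by blast
qed

end

theory Submission
  imports Defs
begin

text \<open>
  The inclusions \<open>M\<^sub>i \<rightarrow> M\<close> and the retractions \<open>M \<rightarrow> M\<^sub>i\<close> collapsing the other summands to the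
  base point are nonexpansive, so composition with them preserves Lipschitz compactness and does
  not increase norms, and the norm on \<open>M\<close> is the supremum of the norms of the restrictions.

  Given \<open>F\<close> on \<open>M\<close>, choose \<open>i\<close> with \<open>\<parallel>F\<^sub>i\<parallel>\<close> close to \<open>\<parallel>F\<parallel>\<close>, enlarge \<open>F\<^sub>i\<close> slightly and approximate the
  result by a norm attaining map of norm at least \<open>\<parallel>F\<parallel>\<close>; replacing \<open>F\<^sub>i\<close> by this map gives a norm
  attaining map on \<open>M\<close>. Conversely, a norm attaining map close to the extension by zero of a nonzero
  map on \<open>M\<^sub>i\<close> has small slopes outside \<open>M\<^sub>i\<close>, so its norm is attained inside \<open>M\<^sub>i\<close>.
\<close>

section \<open>Relative compactness, the Lipschitz norm and norm attainment\<close>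

lemma compact_closure_subset:
  fixes S K :: "'a::t2_space set"
  assumes "compact K" "S \<subseteq> K"
  shows "compact (closure S)"
proof -
  have "closure S \<subseteq> K"
    using assms by (simp add: closure_minimal compact_imp_closed)
  then have "K \<inter> closure S = closure S" by blast
  with compact_Int_closed[OF assms(1) closed_closure, of S] show ?thesis by simp
qed

lemma Lip0_iff:
  "F \<in> Lip0 m z \<longleftrightarrow>
     (\<exists>B. \<forall>x\<in>mspace m. \<forall>y\<in>mspace m. norm (F x - F y) \<le> B * mdist m x y) \<and> F z = 0 \<and>
     (\<forall>x. x \<notin> mspace m \<longrightarrow> F x = 0)"
  by (auto simp: Lip0_def Lipschitz_continuous_map_def dist_norm)

lemma Lip0_base: "F \<in> Lip0 m z \<Longrightarrow> F z = 0"
  and Lip0_outside: "F \<in> Lip0 m z \<Longrightarrow> x \<notin> mspace m \<Longrightarrow> F x = 0"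
  by (simp_all add: Lip0_iff)

lemma Lip0K_imp_Lip0: "F \<in> Lip0K m z \<Longrightarrow> F \<in> Lip0 m z"
  by (simp add: Lip0K_def)

lemma mdist_pos: "x \<in> mspace m \<Longrightarrow> y \<in> mspace m \<Longrightarrow> x \<noteq> y \<Longrightarrow> 0 < mdist m x y"
  using mdist_nonneg[of m x y] mdist_zero[of x m y] by (simp add: less_le)

lemma mdist_self [simp]: "x \<in> mspace m \<Longrightarrow> mdist m x x = 0"
  by simp

text \<open>A Lipschitz constant of \<open>F\<close> bounds all difference quotients from above, so
  each quotient is at most their supremum. The product form also covers
  \<open>x = y\<close>.\<close>

lemma norm_diff_le_lip_norm:
  assumes F: "F \<in> Lip0 m z" and x: "x \<in> mspace m" and y: "y \<in> mspace m"
  shows "norm (F x - F y) \<le> lip_norm m F * mdist m x y"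
proof (cases "x = y")
  case False
  obtain B where B: "\<And>p q. p \<in> mspace m \<Longrightarrow> q \<in> mspace m \<Longrightarrow> norm (F p - F q) \<le> B * mdist m p q"
    using F by (auto simp: Lip0_iff)
  have "norm (F x - F y) / mdist m x y \<le> lip_norm m F"
    unfolding lip_norm_def
  proof (rule cSup_upper)
    show "bdd_above {norm (F p - F q) / mdist m p q |p q. p \<in> mspace m \<and> q \<in> mspace m \<and> p \<noteq> q}"
      using B mdist_pos by (fastforce intro!: bdd_aboveI[of _ B] simp: divide_le_eq)
  qed (use x y False in blast)
  then show ?thesis using mdist_pos[OF x y False] by (simp add: divide_le_eq)
qed (use y in simp)

text \<open>Two distinct points make the set of quotients nonempty, so its real supremum is at most
  every upper bound.\<close>

lemma lip_norm_le:
  assumes m: "pointed_metric_space m z"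
    and L: "\<And>x y. x \<in> mspace m \<Longrightarrow> y \<in> mspace m \<Longrightarrow> norm (F x - F y) \<le> L * mdist m x y"
  shows "lip_norm m F \<le> L"
  unfolding lip_norm_def
proof (rule cSup_least)
  show "{norm (F p - F q) / mdist m p q |p q. p \<in> mspace m \<and> q \<in> mspace m \<and> p \<noteq> q} \<noteq> {}"
    using m unfolding pointed_metric_space_def by blast
qed (use L mdist_pos in \<open>fastforce simp: divide_le_eq\<close>)

lemma lip_norm_nonneg:
  assumes m: "pointed_metric_space m z" and F: "F \<in> Lip0 m z"
  shows "0 \<le> lip_norm m F"
proof -
  obtain x where x: "x \<in> mspace m" "x \<noteq> z" "z \<in> mspace m"
    using m unfolding pointed_metric_space_def by blast
  have "0 \<le> lip_norm m F * mdist m x z"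
    using norm_diff_le_lip_norm[OF F x(1,3)] norm_ge_zero order_trans by blast
  then show ?thesis using mdist_pos[OF x(1,3,2)] by (simp add: zero_le_mult_iff)
qed

text \<open>A Lipschitz constant \<open>L\<close> reached by one pair is both an upper and a lower
  bound of the norm. Attainment can thus be shown without first computing
  \<open>lip_norm m F\<close>.\<close>

lemma strongly_attains_normI:
  assumes m: "pointed_metric_space m z" and F: "F \<in> Lip0 m z"
    and L: "\<And>x y. x \<in> mspace m \<Longrightarrow> y \<in> mspace m \<Longrightarrow> norm (F x - F y) \<le> L * mdist m x y"
    and pq: "p \<in> mspace m" "q \<in> mspace m" "p \<noteq> q" and ge: "L * mdist m p q \<le> norm (F p - F q)"
  shows "strongly_attains_norm m F"
proof -
  have d: "0 < mdist m p q" using mdist_pos[OF pq] .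
  have "L * mdist m p q \<le> lip_norm m F * mdist m p q"
    using ge norm_diff_le_lip_norm[OF F pq(1,2)] by linarith
  then have "L = lip_norm m F"
    using d lip_norm_le[where F=F and L=L, OF m L] by auto
  moreover have "norm (F p - F q) = L * mdist m p q"
    using ge L pq(1,2) by (simp add: antisym)
  ultimately have "norm (F p - F q) / mdist m p q = lip_norm m F" using d by simp
  then show ?thesis using pq unfolding strongly_attains_norm_def by blast
qed

lemma strongly_attains_normE:
  assumes "strongly_attains_norm m F"
  obtains p q where "p \<in> mspace m" "q \<in> mspace m" "p \<noteq> q"
    "norm (F p - F q) = lip_norm m F * mdist m p q"
proof -
  obtain p q where pq: "p \<in> mspace m" "q \<in> mspace m" "p \<noteq> q"
    and e: "norm (F p - F q) / mdist m p q = lip_norm m F"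
    using assms unfolding strongly_attains_norm_def by blast
  have "norm (F p - F q) = lip_norm m F * mdist m p q"
    using e mdist_pos[OF pq] by (simp add: field_simps)
  with pq show ?thesis by (rule that)
qed

text \<open>Settles the degenerate case of both density proofs, where the map is its own
  approximation: when the norm is zero, any two distinct points attain it.\<close>

lemma strongly_attains_norm_if_lip_norm_le_0:
  assumes m: "pointed_metric_space m z" and F: "F \<in> Lip0 m z" and "lip_norm m F \<le> 0"
  shows "strongly_attains_norm m F"
proof -
  have N: "lip_norm m F = 0" using lip_norm_nonneg[OF m F] assms(3) by simp
  obtain x where x: "x \<in> mspace m" "z \<in> mspace m" "x \<noteq> z"
    using m unfolding pointed_metric_space_def by blast
  show ?thesis
    by (rule strongly_attains_normI[OF m F norm_diff_le_lip_norm[OF F] x]) (simp_all add: N)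
qed

section \<open>Linear combinations of Lipschitz and Lipschitz compact maps\<close>

lemma Lip0_linear_combination:
  assumes F: "F \<in> Lip0 m z" and G: "G \<in> Lip0 m z"
  shows "(\<lambda>x. a *\<^sub>R F x + b *\<^sub>R G x) \<in> Lip0 m z"
proof -
  have "norm ((a *\<^sub>R F x + b *\<^sub>R G x) - (a *\<^sub>R F y + b *\<^sub>R G y))
      \<le> (\<bar>a\<bar> * lip_norm m F + \<bar>b\<bar> * lip_norm m G) * mdist m x y"
    if x: "x \<in> mspace m" and y: "y \<in> mspace m" for x y
  proof -
    have "norm ((a *\<^sub>R F x + b *\<^sub>R G x) - (a *\<^sub>R F y + b *\<^sub>R G y))
        = norm (a *\<^sub>R (F x - F y) + b *\<^sub>R (G x - G y))"
      by (simp add: algebra_simps)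
    also have "\<dots> \<le> \<bar>a\<bar> * norm (F x - F y) + \<bar>b\<bar> * norm (G x - G y)"
      by (rule norm_triangle_le) simp
    also have "\<dots> \<le> \<bar>a\<bar> * (lip_norm m F * mdist m x y) + \<bar>b\<bar> * (lip_norm m G * mdist m x y)"
      by (intro add_mono mult_left_mono norm_diff_le_lip_norm[OF F x y] norm_diff_le_lip_norm[OF G x y]) auto
    finally show ?thesis by (simp add: algebra_simps)
  qed
  then show ?thesis using F G unfolding Lip0_iff by auto
qed

lemma slope_in_closure:
  assumes "p \<in> mspace m" "q \<in> mspace m" "p \<noteq> q"
  shows "(F p - F q) /\<^sub>R mdist m p q \<in> closure (lip_slopes m F)"
proof (rule subsetD[OF closure_subset])
  show "(F p - F q) /\<^sub>R mdist m p q \<in> lip_slopes m F"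
    using assms unfolding lip_slopes_def by blast
qed

text \<open>Each slope of the combination is the same combination of a slope of \<open>F\<close> and
  a slope of \<open>G\<close>, so it lies in the sum of two scaled compact sets.\<close>

lemma Lip0K_linear_combination:
  assumes F: "F \<in> Lip0K m z" and G: "G \<in> Lip0K m z"
  shows "(\<lambda>x. a *\<^sub>R F x + b *\<^sub>R G x) \<in> Lip0K m z"
proof -
  let ?K = "{u + v |u v. u \<in> (*\<^sub>R) a ` closure (lip_slopes m F) \<and> v \<in> (*\<^sub>R) b ` closure (lip_slopes m G)}"
  have "compact ?K"
    using F G by (intro compact_sums compact_scaling) (auto simp: Lip0K_def)
  moreover have "lip_slopes m (\<lambda>x. a *\<^sub>R F x + b *\<^sub>R G x) \<subseteq> ?K"
  proof
    fix s assume "s \<in> lip_slopes m (\<lambda>x. a *\<^sub>R F x + b *\<^sub>R G x)"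
    then obtain p q where pq: "p \<in> mspace m" "q \<in> mspace m" "p \<noteq> q"
      and s: "s = ((a *\<^sub>R F p + b *\<^sub>R G p) - (a *\<^sub>R F q + b *\<^sub>R G q)) /\<^sub>R mdist m p q"
      unfolding lip_slopes_def by blast
    have "s = a *\<^sub>R ((F p - F q) /\<^sub>R mdist m p q) + b *\<^sub>R ((G p - G q) /\<^sub>R mdist m p q)"
      by (simp add: s algebra_simps)
    then show "s \<in> ?K" using slope_in_closure[OF pq, of F] slope_in_closure[OF pq, of G] by blast
  qed
  ultimately show ?thesis
    using compact_closure_subset Lip0_linear_combination F G by (auto simp: Lip0K_def)
qed

lemma Lip0_diff:
  assumes "F \<in> Lip0 m z" "G \<in> Lip0 m z"
  shows "(\<lambda>x. F x - G x) \<in> Lip0 m z"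
  using Lip0_linear_combination[OF assms, of 1 "-1"] by simp

lemma Lip0K_diff:
  assumes "F \<in> Lip0K m z" "G \<in> Lip0K m z"
  shows "(\<lambda>x. F x - G x) \<in> Lip0K m z"
  using Lip0K_linear_combination[OF assms, of 1 "-1"] by simp

lemma Lip0K_scaleR:
  assumes "F \<in> Lip0K m z"
  shows "(\<lambda>x. c *\<^sub>R F x) \<in> Lip0K m z"
  using Lip0K_linear_combination[OF assms assms, of c 0] by simp

text \<open>In this form the inequality bounds the norm of an approximation \<open>G\<close> of
  \<open>F\<close> from below.\<close>

lemma lip_norm_triangle:
  assumes m: "pointed_metric_space m z" and F: "F \<in> Lip0 m z" and G: "G \<in> Lip0 m z"
  shows "lip_norm m F \<le> lip_norm m G + lip_norm m (\<lambda>x. F x - G x)"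
proof (rule lip_norm_le[OF m])
  fix x y assume xy: "x \<in> mspace m" "y \<in> mspace m"
  have "norm (F x - F y) \<le> norm (G x - G y) + norm ((F x - G x) - (F y - G y))"
    using norm_triangle_ineq[of "G x - G y" "(F x - G x) - (F y - G y)"] by simp
  also have "\<dots> \<le> lip_norm m G * mdist m x y + lip_norm m (\<lambda>x. F x - G x) * mdist m x y"
    using norm_diff_le_lip_norm[OF G xy] norm_diff_le_lip_norm[OF Lip0_diff[OF F G] xy] by simp
  finally show "norm (F x - F y) \<le> (lip_norm m G + lip_norm m (\<lambda>x. F x - G x)) * mdist m x y"
    by (simp add: algebra_simps)
qed

lemma lip_norm_scaleR_le:
  assumes m: "pointed_metric_space m z" and F: "F \<in> Lip0 m z"
  shows "lip_norm m (\<lambda>x. c *\<^sub>R F x) \<le> \<bar>c\<bar> * lip_norm m F"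
proof (rule lip_norm_le[OF m])
  fix x y assume xy: "x \<in> mspace m" "y \<in> mspace m"
  have "\<bar>c\<bar> * norm (F x - F y) \<le> \<bar>c\<bar> * (lip_norm m F * mdist m x y)"
    by (intro mult_left_mono norm_diff_le_lip_norm[OF F xy]) simp
  then show "norm (c *\<^sub>R F x - c *\<^sub>R F y) \<le> \<bar>c\<bar> * lip_norm m F * mdist m x y"
    by (simp flip: scaleR_diff_right add: mult.assoc)
qed

section \<open>Composition with nonexpansive maps\<close>

lemma norm_diff_compose_le:
  assumes m: "pointed_metric_space m z" and F: "F \<in> Lip0 m z" and f: "f ` mspace m' \<subseteq> mspace m"
    and ne: "\<And>x y. x \<in> mspace m' \<Longrightarrow> y \<in> mspace m' \<Longrightarrow> mdist m (f x) (f y) \<le> mdist m' x y"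
    and x: "x \<in> mspace m'" and y: "y \<in> mspace m'"
  shows "norm (F (f x) - F (f y)) \<le> lip_norm m F * mdist m' x y"
proof -
  have "norm (F (f x) - F (f y)) \<le> lip_norm m F * mdist m (f x) (f y)"
    using norm_diff_le_lip_norm[OF F] f x y by blast
  also have "\<dots> \<le> lip_norm m F * mdist m' x y"
    by (intro mult_left_mono ne x y lip_norm_nonneg[OF m F])
  finally show ?thesis .
qed

text \<open>A slope of \<open>F \<circ> f\<close> is \<open>0\<close> or a slope of \<open>F\<close> scaled by a factor in \<open>[0, 1]\<close>.\<close>

lemma Lip0K_compose:
  assumes m: "pointed_metric_space m z" and F: "F \<in> Lip0K m z" and f: "f ` mspace m' \<subseteq> mspace m"
    and ne: "\<And>x y. x \<in> mspace m' \<Longrightarrow> y \<in> mspace m' \<Longrightarrow> mdist m (f x) (f y) \<le> mdist m' x y"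
    and base: "f z' = z" and out: "\<And>x. x \<notin> mspace m' \<Longrightarrow> F (f x) = 0"
  shows "(\<lambda>x. F (f x)) \<in> Lip0K m' z'"
proof -
  note F0 = Lip0K_imp_Lip0[OF F]
  let ?K = "insert 0 ((\<lambda>(t, s). t *\<^sub>R s) ` ({0..1} \<times> closure (lip_slopes m F)))"
  have "compact ?K"
    using F by (intro compact_insert compact_continuous_image compact_Times)
               (auto simp: Lip0K_def case_prod_unfold intro!: continuous_intros)
  moreover have "lip_slopes m' (\<lambda>x. F (f x)) \<subseteq> ?K"
  proof
    fix s assume "s \<in> lip_slopes m' (\<lambda>x. F (f x))"
    then obtain p q where pq: "p \<in> mspace m'" "q \<in> mspace m'" "p \<noteq> q"
      and s: "s = (F (f p) - F (f q)) /\<^sub>R mdist m' p q"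
      unfolding lip_slopes_def by blast
    show "s \<in> ?K"
    proof (cases "f p = f q")
      case False
      have fpq: "f p \<in> mspace m" "f q \<in> mspace m" using f pq by auto
      let ?t = "mdist m (f p) (f q) / mdist m' p q"
      have "0 < mdist m (f p) (f q)" "0 < mdist m' p q"
        using mdist_pos[OF fpq False] mdist_pos[OF pq] .
      then have "?t \<in> {0..1}" "s = ?t *\<^sub>R ((F (f p) - F (f q)) /\<^sub>R mdist m (f p) (f q))"
        using ne[OF pq(1,2)] by (simp_all add: s field_simps)
      moreover have "(F (f p) - F (f q)) /\<^sub>R mdist m (f p) (f q) \<in> closure (lip_slopes m F)"
        using slope_in_closure[OF fpq False] .
      ultimately show ?thesis
        by (intro insertI2 image_eqI[where x="(?t, (F (f p) - F (f q)) /\<^sub>R mdist m (f p) (f q))"])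
           (simp_all only: prod.case mem_Times_iff fst_conv snd_conv simp_thms)
    qed (simp add: s)
  qed
  ultimately have "compact (closure (lip_slopes m' (\<lambda>x. F (f x))))"
    by (rule compact_closure_subset)
  moreover have "(\<lambda>x. F (f x)) \<in> Lip0 m' z'"
    using norm_diff_compose_le[OF m F0 f ne] out base Lip0_base[OF F0] unfolding Lip0_iff by blast
  ultimately show ?thesis by (simp add: Lip0K_def)
qed

lemma lip_norm_compose_le:
  assumes m: "pointed_metric_space m z" and m': "pointed_metric_space m' z'"
    and F: "F \<in> Lip0 m z" and f: "f ` mspace m' \<subseteq> mspace m"
    and ne: "\<And>x y. x \<in> mspace m' \<Longrightarrow> y \<in> mspace m' \<Longrightarrow> mdist m (f x) (f y) \<le> mdist m' x y"
  shows "lip_norm m' (\<lambda>x. F (f x)) \<le> lip_norm m F"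
  using norm_diff_compose_le[OF m F f ne] by (rule lip_norm_le[OF m'])

section \<open>Inclusions into the metric sum and retractions onto its summands\<close>

definition sum_proj :: "('i \<Rightarrow> 'a) \<Rightarrow> 'i \<Rightarrow> ('i \<times> 'a) option \<Rightarrow> 'a" where
  "sum_proj z i u = (case u of None \<Rightarrow> z i | Some (j, x) \<Rightarrow> if j = i then x else z i)"

lemma sum_proj_None [simp]: "sum_proj z i None = z i"
  and sum_proj_incl [simp]: "sum_proj z i (sum_incl z j x) = (if j = i then x else z i)"
  and sum_incl_base [simp]: "sum_incl z i (z i) = None"
  by (simp_all add: sum_proj_def sum_incl_def)

locale pointed_metric_family =
  fixes I :: "'i set" and M :: "'i \<Rightarrow> 'a metric" and z :: "'i \<Rightarrow> 'a"
  assumes nonempty: "I \<noteq> {}"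
    and pointed: "i \<in> I \<Longrightarrow> pointed_metric_space (M i) (z i)"
begin

abbreviation "S \<equiv> metric_sum I M z"

lemma base_in: "i \<in> I \<Longrightarrow> z i \<in> mspace (M i)"
  using pointed by (simp add: pointed_metric_space_def)

lemma pointed_sum: "pointed_metric_space S None"
  using pointed_metric_space_sum[OF nonempty pointed] .

lemma mspace_sum: "mspace S = (\<Union>i\<in>I. sum_incl z i ` mspace (M i))"
  by (rule mspace_metric_sum) (rule base_in)

lemma mdist_incl:
  assumes "i \<in> I" "j \<in> I" "x \<in> mspace (M i)" "y \<in> mspace (M j)"
  shows "mdist S (sum_incl z i x) (sum_incl z j y) =
    (if i = j then mdist (M i) x y else mdist (M i) x (z i) + mdist (M j) (z j) y)"
  by (rule mdist_metric_sum_incl[OF _ assms]) (rule base_in)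

lemma sum_incl_in: "i \<in> I \<Longrightarrow> sum_incl z i ` mspace (M i) \<subseteq> mspace S"
  by (auto simp: mspace_sum)

lemma sum_proj_in: "i \<in> I \<Longrightarrow> sum_proj z i ` mspace S \<subseteq> mspace (M i)"
  by (auto simp: mspace_sum base_in)

text \<open>The inclusion is an isometry; the inequality is the form in which the composition lemmas
  ask for nonexpansiveness.\<close>

lemma mdist_sum_incl_le:
  assumes "i \<in> I" "x \<in> mspace (M i)" "y \<in> mspace (M i)"
  shows "mdist S (sum_incl z i x) (sum_incl z i y) \<le> mdist (M i) x y"
  using assms by (simp add: mdist_incl)

text \<open>Points of the \<open>i\<close>-th summand keep their distance and all others go to
  \<open>z i\<close>. A mixed distance loses its leg outside the summand, and two points outside it
  get distance 0.\<close>

lemma mdist_sum_proj_le: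
  assumes i: "i \<in> I" and "u \<in> mspace S" "v \<in> mspace S"
  shows "mdist (M i) (sum_proj z i u) (sum_proj z i v) \<le> mdist S u v"
proof -
  obtain j x k y where "j \<in> I" "k \<in> I" "x \<in> mspace (M j)" "y \<in> mspace (M k)"
    "u = sum_incl z j x" "v = sum_incl z k y"
    using assms by (auto simp: mspace_sum)
  then show ?thesis using i base_in by (auto simp: mdist_incl)
qed

lemma outside_incl:
  assumes "i \<in> I" "x \<notin> mspace (M i)"
  shows "sum_incl z i x \<notin> mspace S"
  using assms base_in by (auto simp: mspace_sum sum_incl_def split: if_splits)

text \<open>Shows that composing with the retraction respects the convention of extending maps by
  zero.\<close>

lemma Lip0_proj_outside:
  assumes i: "i \<in> I" and F: "F \<in> Lip0 (M i) (z i)" and u: "u \<notin> mspace S"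
  shows "F (sum_proj z i u) = 0"
proof (cases u)
  case None
  then show ?thesis using Lip0_base[OF F] by simp
next
  case (Some a)
  then obtain j x where [simp]: "u = Some (j, x)" by (cases a) auto
  \<comment> \<open>The value \<open>Some (i, z i)\<close> is not a point of the sum, since the base
    point is encoded as \<open>None\<close>; it still projects to \<open>z i\<close>, where
    \<open>F\<close> vanishes.\<close>
  consider "j \<noteq> i" | "x = z i" | "j = i" "x \<notin> mspace (M i)"
    using u i by (force simp: mspace_sum sum_incl_def)
  then show ?thesis
    using Lip0_base[OF F] Lip0_outside[OF F, of x] by cases (auto simp: sum_proj_def)
qed

lemma Lip0K_incl:
  assumes i: "i \<in> I" and F: "F \<in> Lip0K S None"
  shows "(\<lambda>x. F (sum_incl z i x)) \<in> Lip0K (M i) (z i)"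
  using Lip0_outside[OF Lip0K_imp_Lip0[OF F]] outside_incl[OF i]
  by (intro Lip0K_compose[OF pointed_sum F sum_incl_in[OF i] mdist_sum_incl_le[OF i]]) auto

lemma lip_norm_incl_le:
  assumes i: "i \<in> I" and F: "F \<in> Lip0 S None"
  shows "lip_norm (M i) (\<lambda>x. F (sum_incl z i x)) \<le> lip_norm S F"
  by (rule lip_norm_compose_le[OF pointed_sum pointed[OF i] F sum_incl_in[OF i] mdist_sum_incl_le[OF i]])

lemma Lip0K_proj:
  assumes i: "i \<in> I" and F: "F \<in> Lip0K (M i) (z i)"
  shows "(\<lambda>u. F (sum_proj z i u)) \<in> Lip0K S None"
  using Lip0_proj_outside[OF i Lip0K_imp_Lip0[OF F]]
  by (intro Lip0K_compose[OF pointed[OF i] F sum_proj_in[OF i] mdist_sum_proj_le[OF i]]) auto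

lemma lip_norm_proj_le:
  assumes i: "i \<in> I" and F: "F \<in> Lip0 (M i) (z i)"
  shows "lip_norm S (\<lambda>u. F (sum_proj z i u)) \<le> lip_norm (M i) F"
  by (rule lip_norm_compose_le[OF pointed[OF i] pointed_sum F sum_proj_in[OF i] mdist_sum_proj_le[OF i]])

text \<open>Distances between different summands add up through the base point, so the triangle
  inequality via \<open>F None\<close> lets a Lipschitz constant be checked on each summand
  separately.\<close>

lemma norm_diff_glue_le:
  assumes L: "\<And>j x y. j \<in> I \<Longrightarrow> x \<in> mspace (M j) \<Longrightarrow> y \<in> mspace (M j) \<Longrightarrow>
      norm (F (sum_incl z j x) - F (sum_incl z j y)) \<le> L * mdist (M j) x y"
    and u: "u \<in> mspace S" and v: "v \<in> mspace S"
  shows "norm (F u - F v) \<le> L * mdist S u v"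
proof -
  obtain j x k y where jk: "j \<in> I" "k \<in> I" and xy: "x \<in> mspace (M j)" "y \<in> mspace (M k)"
    and uv: "u = sum_incl z j x" "v = sum_incl z k y"
    using u v by (auto simp: mspace_sum)
  show ?thesis
  proof (cases "j = k")
    case True
    then show ?thesis using L jk xy by (simp add: uv mdist_incl)
  next
    case False
    have "norm (F u - F v) \<le> norm (F u - F None) + norm (F None - F v)"
      by norm
    also have "\<dots> \<le> L * mdist (M j) x (z j) + L * mdist (M k) (z k) y"
      using L[OF jk(1) xy(1) base_in[OF jk(1)]] L[OF jk(2) base_in[OF jk(2)] xy(2)] by (simp add: uv)
    finally show ?thesis using False jk xy by (simp add: uv mdist_incl algebra_simps)
  qed
qed

section \<open>Density passes from the summands to the sum\<close>

lemma dense_sum_if_dense_summands: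
  assumes dense: "\<And>i. i \<in> I \<Longrightarrow>
      lip_dense_in (M i) (LipSNAK (M i) (z i) :: ('a \<Rightarrow> 'y::real_normed_vector) set) (Lip0K (M i) (z i))"
  shows "lip_dense_in S (LipSNAK S None :: (('i \<times> 'a) option \<Rightarrow> 'y) set) (Lip0K S None)"
  unfolding lip_dense_in_def
proof (intro conjI ballI allI impI)
  show "LipSNAK S None \<subseteq> (Lip0K S None :: (('i \<times> 'a) option \<Rightarrow> 'y) set)"
    by (auto simp: LipSNAK_def)
  fix F :: "('i \<times> 'a) option \<Rightarrow> 'y" and \<epsilon> :: real
  assume F: "F \<in> Lip0K S None" and \<epsilon>: "\<epsilon> > 0"
  note F0 = Lip0K_imp_Lip0[OF F]
  let ?N = "lip_norm S F"
  show "\<exists>G\<in>LipSNAK S None. lip_norm S (\<lambda>x. F x - G x) < \<epsilon>"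
  proof (cases "?N \<le> 0")
    case True
    then have "F \<in> LipSNAK S None"
      using strongly_attains_norm_if_lip_norm_le_0[OF pointed_sum F0] F by (simp add: LipSNAK_def)
    moreover have "lip_norm S (\<lambda>x. F x - F x) \<le> 0"
      by (rule lip_norm_le[OF pointed_sum]) simp
    ultimately show ?thesis by (intro bexI[of _ F] le_less_trans[OF _ \<epsilon>])
  next
    case False
    \<comment> \<open>The budget: choosing \<open>i\<close> loses less than \<open>e/4\<close>,
      enlarging gains \<open>e/2\<close>, approximating loses less than \<open>e/4\<close>, so the
      norm ends up at least \<open>?N\<close>. The total change stays below
      \<open>e/2 + e/4\<close>. The bound \<open>e \<le> ?N\<close> makes the norm on the chosen
      summand positive.\<close>
    define e where "e = min \<epsilon> ?N"
    have e: "0 < e" "e \<le> \<epsilon>" "e \<le> ?N" using False \<epsilon> by (auto simp: e_def)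
    define R where "R j = (\<lambda>x. F (sum_incl z j x))" for j
    have R: "R j \<in> Lip0K (M j) (z j)" "R j \<in> Lip0 (M j) (z j)" if "j \<in> I" for j
      using Lip0K_incl[OF that F] Lip0K_imp_Lip0 by (auto simp: R_def)
    have R_le: "lip_norm (M j) (R j) \<le> ?N" if "j \<in> I" for j
      using lip_norm_incl_le[OF that F0] by (simp add: R_def)
    have "\<exists>i\<in>I. ?N - e/4 < lip_norm (M i) (R i)"
    proof (rule ccontr)
      assume "\<not> ?thesis"
      then have le: "lip_norm (M i) (R i) \<le> ?N - e/4" if "i \<in> I" for i
        using that by auto
      \<comment> \<open>If no restriction came close to \<open>?N\<close>, gluing would give
        \<open>F\<close> a Lipschitz constant smaller than its norm.\<close>
      have "?N \<le> ?N - e/4"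
      proof (rule lip_norm_le[OF pointed_sum], rule norm_diff_glue_le)
        fix j x y assume j: "j \<in> I" and xy: "x \<in> mspace (M j)" "y \<in> mspace (M j)"
        have "norm (R j x - R j y) \<le> lip_norm (M j) (R j) * mdist (M j) x y"
          by (rule norm_diff_le_lip_norm[OF R(2)[OF j] xy])
        also have "\<dots> \<le> (?N - e/4) * mdist (M j) x y"
          by (rule mult_right_mono[OF le[OF j]]) simp
        finally show "norm (F (sum_incl z j x) - F (sum_incl z j y)) \<le> (?N - e/4) * mdist (M j) x y"
          by (simp add: R_def)
      qed
      with e show False by simp
    qed
    then obtain i where i: "i \<in> I" and Ni: "?N - e/4 < lip_norm (M i) (R i)" by blast
    let ?n = "lip_norm (M i) (R i)"
    have n: "0 < ?n" using e Ni by linarith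
    \<comment> \<open>The factor is chosen so that scaling raises the norm \<open>?n\<close> by
      \<open>e/2\<close>.\<close>
    define c where "c = 1 + (e/2) / ?n"
    have c: "1 \<le> c" "c * ?n = ?n + e/2" using n e by (simp_all add: c_def field_simps)
    define H where "H = (\<lambda>x. c *\<^sub>R R i x)"
    have H: "H \<in> Lip0K (M i) (z i)" unfolding H_def by (rule Lip0K_scaleR[OF R(1)[OF i]])
    note H0 = Lip0K_imp_Lip0[OF H]
    \<comment> \<open>The lower bound on the norm of \<open>H\<close> comes from the upper estimate
      for scaling, applied to \<open>R i\<close> as the multiple of \<open>H\<close> by
      \<open>inverse c\<close>.\<close>
    have "lip_norm (M i) (\<lambda>x. inverse c *\<^sub>R H x) \<le> \<bar>inverse c\<bar> * lip_norm (M i) H"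
      by (rule lip_norm_scaleR_le[OF pointed[OF i] H0])
    then have "?n \<le> lip_norm (M i) H / c" using c(1) by (simp add: H_def field_simps)
    then have nH: "?n + e/2 \<le> lip_norm (M i) H" using c by (simp add: field_simps)
    have RH: "lip_norm (M i) (\<lambda>x. R i x - H x) \<le> e/2"
    proof -
      have "lip_norm (M i) (\<lambda>x. (1 - c) *\<^sub>R R i x) \<le> \<bar>1 - c\<bar> * ?n"
        by (rule lip_norm_scaleR_le[OF pointed[OF i] R(2)[OF i]])
      also have "\<dots> = e/2" using c by (simp add: algebra_simps)
      finally show ?thesis by (simp add: H_def algebra_simps)
    qed
    obtain g where g: "g \<in> LipSNAK (M i) (z i)" and gH: "lip_norm (M i) (\<lambda>x. H x - g x) < e/4"
      using dense[OF i] H e(1) unfolding lip_dense_in_def by (meson divide_pos_pos zero_less_numeral)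
    have gK: "g \<in> Lip0K (M i) (z i)" and g_att: "strongly_attains_norm (M i) g"
      using g by (auto simp: LipSNAK_def)
    note g0 = Lip0K_imp_Lip0[OF gK]
    have Ng: "?N \<le> lip_norm (M i) g"
      using lip_norm_triangle[OF pointed[OF i] H0 g0] nH gH Ni e by linarith
    have Rg: "lip_norm (M i) (\<lambda>x. R i x - g x) < \<epsilon>"
      using lip_norm_triangle[OF pointed[OF i] Lip0_diff[OF R(2)[OF i] g0] Lip0_diff[OF R(2)[OF i] H0]]
        RH gH e by simp
    \<comment> \<open>Subtracting the extension by zero of \<open>R i - g\<close> changes
      \<open>F\<close> only on the \<open>i\<close>-th summand, where it becomes \<open>g\<close>.
      Written as a difference, \<open>G\<close> is Lipschitz compact by linearity.\<close>
    define G where "G = (\<lambda>u. F u - (R i (sum_proj z i u) - g (sum_proj z i u)))"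
    have GK: "G \<in> Lip0K S None"
      unfolding G_def by (rule Lip0K_diff[OF F Lip0K_proj[OF i Lip0K_diff[OF R(1)[OF i] gK]]])
    note G0 = Lip0K_imp_Lip0[OF GK]
    have G_incl: "G (sum_incl z j x) = (if j = i then g x else R j x)" for j x
      using Lip0_base[OF R(2)[OF i]] Lip0_base[OF g0] by (simp add: G_def R_def)
    have "lip_norm S (\<lambda>u. F u - G u) < \<epsilon>"
      using lip_norm_proj_le[OF i Lip0_diff[OF R(2)[OF i] g0]] Rg by (simp add: G_def)
    moreover have "strongly_attains_norm S G"
    proof -
      obtain p q where pq: "p \<in> mspace (M i)" "q \<in> mspace (M i)" "p \<noteq> q"
        and att: "norm (g p - g q) = lip_norm (M i) g * mdist (M i) p q"
        using g_att by (rule strongly_attains_normE)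
      \<comment> \<open>On the other summands \<open>G\<close> agrees with \<open>F\<close>, whose
        restrictions have norm at most \<open>?N\<close>, and \<open>Ng\<close> puts this below the
        norm of \<open>g\<close>.\<close>
      have bound: "norm (G u - G v) \<le> lip_norm (M i) g * mdist S u v"
        if "u \<in> mspace S" "v \<in> mspace S" for u v
      proof (rule norm_diff_glue_le[OF _ that])
        fix j x y assume j: "j \<in> I" and xy: "x \<in> mspace (M j)" "y \<in> mspace (M j)"
        show "norm (G (sum_incl z j x) - G (sum_incl z j y)) \<le> lip_norm (M i) g * mdist (M j) x y"
        proof (cases "j = i")
          case True
          then show ?thesis using norm_diff_le_lip_norm[OF g0] xy by (simp add: G_incl)
        next
          case False
          have "norm (R j x - R j y) \<le> lip_norm (M j) (R j) * mdist (M j) x y"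
            by (rule norm_diff_le_lip_norm[OF R(2)[OF j] xy])
          also have "\<dots> \<le> lip_norm (M i) g * mdist (M j) x y"
            by (rule mult_right_mono) (use R_le[OF j] Ng in auto)
          finally show ?thesis using False by (simp add: G_incl)
        qed
      qed
      show ?thesis
      proof (rule strongly_attains_normI[OF pointed_sum G0 bound])
        show "sum_incl z i p \<in> mspace S" "sum_incl z i q \<in> mspace S"
          using sum_incl_in[OF i] pq by auto
        show "sum_incl z i p \<noteq> sum_incl z i q"
          using pq(3) by (auto simp: sum_incl_def)
        show "lip_norm (M i) g * mdist S (sum_incl z i p) (sum_incl z i q)
            \<le> norm (G (sum_incl z i p) - G (sum_incl z i q))"
          using i pq att by (simp add: mdist_incl G_incl)
      qed
    qed
    ultimately show ?thesis using GK by (auto simp: LipSNAK_def)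
  qed
qed

section \<open>Density passes from the sum to each summand\<close>

lemma dense_summand_if_dense_sum:
  assumes dense: "lip_dense_in S (LipSNAK S None :: (('i \<times> 'a) option \<Rightarrow> 'y::real_normed_vector) set)
      (Lip0K S None)"
    and i: "i \<in> I"
  shows "lip_dense_in (M i) (LipSNAK (M i) (z i) :: ('a \<Rightarrow> 'y) set) (Lip0K (M i) (z i))"
  unfolding lip_dense_in_def
proof (intro conjI ballI allI impI)
  show "LipSNAK (M i) (z i) \<subseteq> (Lip0K (M i) (z i) :: ('a \<Rightarrow> 'y) set)"
    by (auto simp: LipSNAK_def)
  fix F :: "'a \<Rightarrow> 'y" and \<epsilon> :: real
  assume F: "F \<in> Lip0K (M i) (z i)" and \<epsilon>: "\<epsilon> > 0"
  note F0 = Lip0K_imp_Lip0[OF F]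
  let ?N = "lip_norm (M i) F"
  show "\<exists>G\<in>LipSNAK (M i) (z i). lip_norm (M i) (\<lambda>x. F x - G x) < \<epsilon>"
  proof (cases "?N \<le> 0")
    case True
    then have "F \<in> LipSNAK (M i) (z i)"
      using strongly_attains_norm_if_lip_norm_le_0[OF pointed[OF i] F0] F by (simp add: LipSNAK_def)
    moreover have "lip_norm (M i) (\<lambda>x. F x - F x) \<le> 0"
      by (rule lip_norm_le[OF pointed[OF i]]) simp
    ultimately show ?thesis by (intro bexI[of _ F] le_less_trans[OF _ \<epsilon>])
  next
    case False
    define E where "E = (\<lambda>u. F (sum_proj z i u))"
    have E: "E \<in> Lip0K S None" unfolding E_def by (rule Lip0K_proj[OF i F])
    note E0 = Lip0K_imp_Lip0[OF E]
    have E_incl: "(\<lambda>x. E (sum_incl z i x)) = F" by (simp add: E_def)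
    \<comment> \<open>With an error below \<open>?N/2\<close>, the norm of \<open>G\<close> exceeds
      \<open>?N/2\<close> and hence the error itself; this gap is \<open>dG\<close>.\<close>
    have "0 < min \<epsilon> (?N/2)" using \<epsilon> False by simp
    then obtain G where G: "G \<in> LipSNAK S None"
      and EG: "lip_norm S (\<lambda>u. E u - G u) < min \<epsilon> (?N/2)"
      using dense E unfolding lip_dense_in_def by blast
    have GK: "G \<in> Lip0K S None" using G by (simp add: LipSNAK_def)
    note G0 = Lip0K_imp_Lip0[OF GK] and D0 = Lip0_diff[OF E0 Lip0K_imp_Lip0[OF GK]]
    let ?d = "lip_norm S (\<lambda>u. E u - G u)"
    have "?N \<le> lip_norm S E" using lip_norm_incl_le[OF i E0] by (simp add: E_incl)
    then have dG: "?d < lip_norm S G"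
      using lip_norm_triangle[OF pointed_sum E0 G0] EG by linarith
    \<comment> \<open>Where \<open>E\<close> vanishes at both points, the increment of
      \<open>G\<close> is that of \<open>E - G\<close> up to sign, so the constant \<open>?d\<close>
      suffices.\<close>
    have away: "norm (G u - G v) < lip_norm S G * mdist S u v"
      if "u \<in> mspace S" "v \<in> mspace S" "u \<noteq> v" "E u = 0" "E v = 0" for u v
    proof -
      have "norm (G u - G v) \<le> ?d * mdist S u v"
        using norm_diff_le_lip_norm[OF D0 that(1,2)] that(4,5) by (simp add: norm_minus_commute)
      also have "\<dots> < lip_norm S G * mdist S u v"
        using dG mdist_pos[OF that(1-3)] by simp
      finally show ?thesis .
    qed
    let ?Mi = "sum_incl z i ` mspace (M i)"
    have base: "None \<in> mspace S" "E None = 0"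
      using pointed_sum Lip0_base[OF E0] by (auto simp: pointed_metric_space_def)
    have base_Mi: "None \<in> ?Mi" using base_in[OF i] by force
    have E_away: "E v = 0" if "v \<in> mspace S" "v \<notin> ?Mi" for v
      using that Lip0_base[OF F0] by (auto simp: E_def mspace_sum)
    \<comment> \<open>The path through the base point realizes the distance. Its leg inside the
      summand obeys the norm bound and its leg outside obeys it strictly by \<open>away\<close>, so
      the sum is strict.\<close>
    have mixed: "norm (G u - G v) < lip_norm S G * mdist S u v"
      if u: "u \<in> ?Mi" and v: "v \<in> mspace S" "v \<notin> ?Mi" for u v
    proof -
      obtain x where x: "x \<in> mspace (M i)" "u = sum_incl z i x" using u by blast
      obtain j y where y: "j \<in> I" "y \<in> mspace (M j)" "v = sum_incl z j y" "j \<noteq> i"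
        using v by (auto simp: mspace_sum)
      have d: "mdist S u v = mdist S u None + mdist S None v"
        using mdist_incl[OF i i x(1) base_in[OF i]] mdist_incl[OF y(1,1) base_in[OF y(1)] y(2)]
          mdist_incl[OF i y(1) x(1) y(2)] x y by simp
      have "norm (G u - G v) \<le> norm (G u - G None) + norm (G None - G v)" by norm
      moreover have "norm (G u - G None) \<le> lip_norm S G * mdist S u None"
        using u sum_incl_in[OF i] by (intro norm_diff_le_lip_norm[OF G0]) (use base in auto)
      moreover have "norm (G None - G v) < lip_norm S G * mdist S None v"
        using v base base_Mi E_away by (intro away) auto
      ultimately show ?thesis by (simp add: d algebra_simps)
    qed
    obtain p q where pq: "p \<in> mspace S" "q \<in> mspace S" "p \<noteq> q"
      and att: "norm (G p - G q) = lip_norm S G * mdist S p q"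
      by (rule strongly_attains_normE[of S G]) (use G in \<open>auto simp: LipSNAK_def\<close>)
    \<comment> \<open>Both points outside the summand contradicts \<open>away\<close>, exactly one
      outside contradicts \<open>mixed\<close>.\<close>
    have "p \<in> ?Mi" "q \<in> ?Mi"
      using away[OF pq] mixed[of p q] mixed[of q p] E_away pq att
      by (auto simp: mdist_commute norm_minus_commute)
    then obtain x y where xy: "x \<in> mspace (M i)" "y \<in> mspace (M i)"
      and pq_eq: "p = sum_incl z i x" "q = sum_incl z i y" by blast
    define g where "g = (\<lambda>x. G (sum_incl z i x))"
    have g: "g \<in> Lip0K (M i) (z i)" unfolding g_def by (rule Lip0K_incl[OF i GK])
    \<comment> \<open>The constant \<open>lip_norm S G\<close> bounds the increments of
      \<open>g\<close> and is reached at \<open>x\<close>, \<open>y\<close>, because the inclusion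
      preserves distances.\<close>
    have "strongly_attains_norm (M i) g"
    proof (rule strongly_attains_normI[OF pointed[OF i] Lip0K_imp_Lip0[OF g]])
      show "norm (g s - g t) \<le> lip_norm S G * mdist (M i) s t"
        if "s \<in> mspace (M i)" "t \<in> mspace (M i)" for s t
        unfolding g_def
        by (rule norm_diff_compose_le[OF pointed_sum G0 sum_incl_in[OF i] mdist_sum_incl_le[OF i] that])
      show "lip_norm S G * mdist (M i) x y \<le> norm (g x - g y)"
        using att xy i by (simp add: g_def pq_eq mdist_incl)
    qed (use xy pq pq_eq in auto)
    moreover have "lip_norm (M i) (\<lambda>x. F x - g x) < \<epsilon>"
      using lip_norm_incl_le[OF i D0] EG by (simp add: g_def E_def)
    ultimately show ?thesis using g by (auto simp: LipSNAK_def)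
  qed
qed

end

theorem proposition2p8:
  fixes I :: "'i set" and M :: "'i \<Rightarrow> 'a metric" and z :: "'i \<Rightarrow> 'a"
  assumes "I \<noteq> {}"
    and "\<And>i. i \<in> I \<Longrightarrow> pointed_metric_space (M i) (z i)"
    and "\<And>i. i \<in> I \<Longrightarrow> mcomplete_of (M i)"
  shows "(\<forall>i\<in>I. lip_dense_in (M i) (LipSNAK (M i) (z i) :: ('a \<Rightarrow> 'y::banach) set)
                                   (Lip0K (M i) (z i)))
     \<longleftrightarrow> lip_dense_in (metric_sum I M z)
           (LipSNAK (metric_sum I M z) None :: (('i \<times> 'a) option \<Rightarrow> 'y) set)
           (Lip0K (metric_sum I M z) None)"
proof -
  interpret pointed_metric_family I M z
    by standard (use assms(1,2) in auto)
  show ?thesis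
    using dense_sum_if_dense_summands dense_summand_if_dense_sum by blast
qed

end
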